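(* Let $\mathcal{N}$ be a nonempty finite or countable set and let $\Gamma(t)=(\gamma_{k,l}(t))_{(k,l)\in\mathcal{N}\times\mathcal{N}}$, $t\in\mathbb{N}$, be row-stochastic matrices. Consider the system $x_k(t+1)=\sum_{l\in\mathcal{N}}\gamma_{k,l}(t)x_l(t)$, $k\in\mathcal{N}$, $t\in\mathbb{N}$, with communication graphs $\mathcal{A}(t)$. Let $T,m$ be positive integers and $\mathcal{I}=\{1,\dots,m\}$. Assume that $(\mathcal{A}(t))_{t\in\mathbb{N}}$ is $T$-sequentially connected by $m$ spanning-trees, and let $(t_p)_{p\in\mathbb{N}}$ be a corresponding strictly increasing integer sequence, i.e. $\limsup_{p\to+\infty}(t_{p+1}-t_p)\le T$ and for each $p\in\mathbb{N}$ the graphs $\mathcal{A}(t_p),\dots,\mathcal{A}(t_{p+1}-1)$ are sequentially connected by $m$ spanning-trees. For each $p\in\mathbb{N}$ and $j\in\mathcal{I}$ let $\mathcal{N}^j_{p,s}$, $s=0,\dots,t_{p+1}-t_p$, be corresponding sets, i.e. $\mathcal{N}^j_{p,0}$ is a singleton, $\mathcal{N}^j_{p,s+1}\subseteq\mathcal{N}^j_{p,s}\cup\mathrm{Neighbors}(\mathcal{N}^j_{p,s},\mathcal{A}(t_p+s))$ for $0\le s<t_{p+1}-t_p$, and $\mathcal{N}^j_{p,t_{p+1}-t_p}=\mathcal{N}$. Let $\mathcal{T}=\{(p,t):p\in\mathbb{N},\ t\in\{t_p,\dots,t_{p+1}-1\}\}$. For each $k\in\mathcal{N}$, $j\in\mathcal{I}$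 and $(p,t)\in\mathcal{T}$ let $\mathcal{N}^{k,j}_{p,t-t_p}\subseteq\mathcal{N}^j_{p,t-t_p}$ be sets such that $j\ne j'$ implies $\mathcal{N}^{k,j}_{p,t-t_p}\cap\mathcal{N}^{k,j'}_{p,t-t_p}=\emptyset$. Assume there are maps $\alpha_{i,j}:\mathcal{T}\to[0,1]$, $(i,j)\in\mathcal{I}\times\mathcal{I}$, such that for all $(p,t)\in\mathcal{T}$, all $i,j\in\mathcal{I}$ and all $k\in\mathcal{N}$, $$k\in\mathcal{N}^i_{p,t-t_p+1}\ \Longrightarrow\ \sum_{l\in\mathcal{N}^{k,j}_{p,t-t_p}}\gamma_{k,l}(t)\ge\alpha_{i,j}(p,t).$$ Then, for every $(p,t)\in\mathcal{T}$, $A(p,t)=(\alpha_{i,j}(p,t))_{(i,j)\in\mathcal{I}\times\mathcal{I}}$ is a sub-stochastic matrix in $\mathbb{R}^{m\times m}$, and the contraction rate $\rho$ of the system satisfies $$\rho\le\limsup_{p\to+\infty}\ \prod_{p'=1}^{p}\left(1-\max_{j\in\mathcal{I}}\mathbf{1}_j^{\mathsf T}A(p',t_{p'+1}-1)\cdots A(p',t_{p'})\mathbf{1}\right)^{1/t_{p+1}}.$$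
   Context: $\mathbb{N}$ includes $0$. A row-stochastic matrix has nonnegative entries and every row sums to $1$; a sub-stochastic matrix is a square matrix with nonnegative entries and all row sums at most $1$. $\mathbf{1}$ is the column vector of ones, $\mathbf{1}_j$ the vector whose components are $0$ except for $1$ in position $j$. In $A(p',t_{p'+1}-1)\cdots A(p',t_{p'})$ the time index decreases from left to right. The state components $x_k$ are real valued. Communication graph at time $t$: the directed graph $\mathcal{A}(t)=\{(k,l)\in\mathcal{N}\times\mathcal{N}:\gamma_{k,l}(t)>0\}$. Neighbors: for a graph $\mathcal{A}\subseteq\mathcal{N}\times\mathcal{N}$ and nonempty $\mathcal{L}\subseteq\mathcal{N}$, $\mathrm{Neighbors}(\mathcal{L},\mathcal{A})$ is the set of $k\in\mathcal{N}\setminus\mathcal{L}$ for which there is $l\in\mathcal{L}$ with $(k,l)\in\mathcal{A}$. Sequential connectivity by $m$ spanning-trees: a finite sequence of graphs $\mathcal{A}_1,\dots,\mathcal{A}_S$ on $\mathcal{N}$ is sequentially connected by $m$ spanning-trees if there are nodes $k^1,\dots,k^m\in\mathcal{N}$ (not required to be distinct) and, for each $j=1,\dots,m$, sets $\mathcal{N}^j_0=\{k^j\}$, $\mathcal{N}^j_s\subseteq\mathcal{N}^j_{s-1}\cup\mathrm{Neighbors}(\mathcal{N}^j_{s-1},\mathcal{A}_s)$ for $s=1,\dots,S$, with $\mathcal{N}^j_S=\mathcal{N}$. $T$-sequential connectivity by $m$ spanning-trees: an infinite sequence of graphs $\mathcal{A}(t)$, $t\in\mathbb{N}$, has this property if there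 is a strictly increasing integer sequence $(t_p)_{p\in\mathbb{N}}$ in $\mathbb{N}$ with $\limsup_{p\to+\infty}(t_{p+1}-t_p)\le T$ such that each finite sequence $\mathcal{A}(t_p),\dots,\mathcal{A}(t_{p+1}-1)$ is sequentially connected by $m$ spanning-trees. Diameter: $\Delta(t)=\Delta(x(t))=\sup_{k\in\mathcal{N}}x_k(t)-\inf_{k\in\mathcal{N}}x_k(t)$. Contraction rate: $\rho=\sup_{x(0)}\limsup_{t\to+\infty}\left(\Delta(t)/\Delta(0)\right)^{1/t}\in[0,+\infty]$, the supremum being over initial states for which the ratio is meaningful, i.e. $0<\Delta(0)<+\infty$ (the supremum of the empty set being $0$). *)

theory Defs
  imports "HOL-Analysis.Analysis"
begin

section \<open>The system on a countable set of nodes\<close>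

text \<open>
  The node set is \<^term>\<open>UNIV :: 'n set\<close> for a type \<open>'n :: countable\<close>: nonempty, and finite or
  countably infinite.
\<close>

definition row_stochastic :: "('n \<Rightarrow> 'n \<Rightarrow> real) \<Rightarrow> bool" where
  "row_stochastic G \<longleftrightarrow> (\<forall>k. (\<forall>l. 0 \<le> G k l) \<and> (G k has_sum 1) UNIV)"

text \<open>
  If \<open>x0\<close> is bounded and all \<open>\<Gamma> t\<close> are row-stochastic, every sum below converges absolutely.
  For unbounded \<open>x0\<close> a sum may diverge and \<open>\<Sum>\<^sub>\<infinity>\<close> is then a junk value; such initial states
  have infinite diameter and do not enter \<open>contraction_rate\<close>.
\<close>

primrec state :: "(nat \<Rightarrow> 'n \<Rightarrow> 'n \<Rightarrow> real) \<Rightarrow> ('n \<Rightarrow> real) \<Rightarrow> nat \<Rightarrow> 'n \<Rightarrow> real" where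
  "state \<Gamma> x0 0 = x0"
| "state \<Gamma> x0 (Suc t) = (\<lambda>k. \<Sum>\<^sub>\<infinity>l. \<Gamma> t k l * state \<Gamma> x0 t l)"

text \<open>
  The supremum exceeds \<open>-\<infinity>\<close> and the infimum is below \<open>\<infinity>\<close>, so the difference is a well-defined
  element of \<open>[0, \<infinity>]\<close> and \<^const>\<open>e2ennreal\<close> does not truncate it.
\<close>

definition diameter :: "('n \<Rightarrow> real) \<Rightarrow> ennreal" where
  "diameter x = e2ennreal ((SUP k. ereal (x k)) - (INF k. ereal (x k)))"

text \<open>Power with exponent \<open>a > 0\<close> on \<open>[0, \<infinity>]\<close>, with \<open>0\<close> and \<open>\<infinity>\<close> as fixed points.\<close>

definition ennreal_powr :: "ennreal \<Rightarrow> real \<Rightarrow> ennreal" where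
  "ennreal_powr x a = (if x = \<infinity> then \<infinity> else ennreal (enn2real x powr a))"

text \<open>
  In \<^typ>\<open>ennreal\<close> the supremum of the empty set is \<open>0\<close>. The value at \<open>t = 0\<close>, where
  \<open>1 / t\<close> is meaningless, does not affect the limit superior.
\<close>

definition contraction_rate :: "(nat \<Rightarrow> 'n \<Rightarrow> 'n \<Rightarrow> real) \<Rightarrow> ennreal" where
  "contraction_rate \<Gamma> =
     (SUP x0 \<in> {x0. 0 < diameter x0 \<and> diameter x0 < \<infinity>}.
        limsup (\<lambda>t. ennreal_powr (diameter (state \<Gamma> x0 t) / diameter x0) (1 / real t)))"


section \<open>Communication graphs and sequential connectivity\<close>

definition comm_graph :: "(nat \<Rightarrow> 'n \<Rightarrow> 'n \<Rightarrow> real) \<Rightarrow> nat \<Rightarrow> ('n \<times> 'n) set" where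
  "comm_graph \<Gamma> t = {(k, l). \<Gamma> t k l > 0}"

definition Neighbors :: "'n set \<Rightarrow> ('n \<times> 'n) set \<Rightarrow> 'n set" where
  "Neighbors L E = {k. k \<notin> L \<and> (\<exists>l\<in>L. (k, l) \<in> E)}"

text \<open>The graph sequence is a list indexed from \<open>0\<close>, so \<open>Es ! s\<close> is its graph number \<open>s + 1\<close>.\<close>

definition sequentially_connected :: "nat \<Rightarrow> ('n \<times> 'n) set list \<Rightarrow> bool" where
  "sequentially_connected m Es \<longleftrightarrow>
     (\<exists>(r :: nat \<Rightarrow> 'n) (W :: nat \<Rightarrow> nat \<Rightarrow> 'n set). \<forall>j\<in>{1..m}.
        W j 0 = {r j} \<and>
        (\<forall>s<length Es. W j (Suc s) \<subseteq> W j s \<union> Neighbors (W j s) (Es ! s)) \<and>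
        W j (length Es) = UNIV)"

definition connecting_times :: "nat \<Rightarrow> nat \<Rightarrow> (nat \<Rightarrow> ('n \<times> 'n) set) \<Rightarrow> (nat \<Rightarrow> nat) \<Rightarrow> bool" where
  "connecting_times T m E tp \<longleftrightarrow>
     strict_mono tp \<and>
     limsup (\<lambda>p. ereal (real (tp (Suc p)) - real (tp p))) \<le> ereal (real T) \<and>
     (\<forall>p. sequentially_connected m (map E [tp p..<tp (Suc p)]))"

definition T_sequentially_connected :: "nat \<Rightarrow> nat \<Rightarrow> (nat \<Rightarrow> ('n \<times> 'n) set) \<Rightarrow> bool" where
  "T_sequentially_connected T m E \<longleftrightarrow> (\<exists>tp. connecting_times T m E tp)"


section \<open>The comparison matrices\<close>

definition block_times :: "(nat \<Rightarrow> nat) \<Rightarrow> (nat \<times> nat) set" where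
  "block_times tp = {(p, t). tp p \<le> t \<and> t < tp (Suc p)}"

definition sub_stochastic :: "real ^ 'm ^ 'm \<Rightarrow> bool" where
  "sub_stochastic A \<longleftrightarrow> (\<forall>i j. 0 \<le> A $ i $ j) \<and> (\<forall>i. (\<Sum>j\<in>UNIV. A $ i $ j) \<le> 1)"

definition coeff_matrix :: "('m \<Rightarrow> 'm \<Rightarrow> nat \<times> nat \<Rightarrow> real) \<Rightarrow> nat \<Rightarrow> nat \<Rightarrow> real ^ 'm ^ 'm" where
  "coeff_matrix \<alpha> p t = (\<chi> i j. \<alpha> i j (p, t))"

text \<open>\<open>left_product B a n = B (a + n - 1) ** \<dots> ** B (a + 1) ** B a\<close>.\<close>

primrec left_product :: "(nat \<Rightarrow> real ^ 'm ^ 'm) \<Rightarrow> nat \<Rightarrow> nat \<Rightarrow> real ^ 'm ^ 'm" where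
  "left_product B a 0 = mat 1"
| "left_product B a (Suc n) = B (a + n) ** left_product B a n"

end

(*
  Inside one block p, let z be a nonnegative solution of the system and let y be the vector of its
  values at the roots of the m trees, at the block's start. By induction on s, every node of the
  i-th set at step s has a z-value of at least (A(p, t_p + s - 1) ... A(p, t_p) y)_i: in the update
  of z_k, keep only the neighbours in the disjoint sets V k j, whose values are bounded below by
  the j-th entry. At the end of the block this holds for all nodes and all i. Applying it to
  z = x - inf x and to z = sup x - x and adding the two bounds, the root values cancel, and the
  diameter shrinks by the factor 1 - (A(p, t_{p+1} - 1) ... A(p, t_p) 1)_i; choose the best i.
  The rate follows since the diameter is non-increasing and t_p / t_{p+1} tends to 1.
*)
theory Submission
  imports Defs
begin

section \<open>Averages of bounded functions with respect to a row-stochastic matrix\<close>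

lemma row_stochasticD:
  assumes "row_stochastic G"
  shows "0 \<le> G k l" and "(G k has_sum 1) UNIV"
  using assms by (auto simp: row_stochastic_def)

lemma row_stochastic_summable_on:
  assumes "row_stochastic G"
  shows "G k summable_on S"
  using summable_on_subset_banach[OF has_sum_imp_summable[OF row_stochasticD(2)[OF assms]]]
  by auto

text \<open>Boundedness of \<open>x\<close> dominates each term by a constant multiple of the
  summable row. General \<open>S\<close> is allowed because rows are later cut into pieces.\<close>

lemma weighted_average_summable_on:
  assumes "row_stochastic G" and "range x \<subseteq> {a..b}"
  shows "(\<lambda>l. G k l * x l) summable_on S"
proof -
  have "norm (G k l * x l) \<le> G k l * max \<bar>a\<bar> \<bar>b\<bar>" for l
  proof -
    have "a \<le> x l" "x l \<le> b" using assms(2) by (auto simp: image_subset_iff)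
    then have "\<bar>x l\<bar> \<le> max \<bar>a\<bar> \<bar>b\<bar>" by linarith
    then show ?thesis
      using row_stochasticD(1)[OF assms(1), of k l] by (simp add: abs_mult mult_left_mono)
  qed
  then have "(\<lambda>l. norm (G k l * x l)) summable_on S"
    by (intro summable_on_comparison_test
          [OF summable_on_cmult_left[OF row_stochastic_summable_on[OF assms(1)]]]) auto
  then show ?thesis by (rule abs_summable_summable)
qed

text \<open>Row sums equal to 1 let the shift \<open>v\<close> pass through the average. This makes
  both \<open>x - lo\<close> and \<open>hi - x\<close> solutions of the system whenever
  \<open>x\<close> is one.\<close>

lemma weighted_average_affine:
  assumes G: "row_stochastic G" and x: "range x \<subseteq> {a..b}"
  shows "(\<Sum>\<^sub>\<infinity>l. G k l * (u * x l + v)) = u * (\<Sum>\<^sub>\<infinity>l. G k l * x l) + v"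
proof -
  have "((\<lambda>l. G k l * x l) has_sum (\<Sum>\<^sub>\<infinity>l. G k l * x l)) UNIV"
    using weighted_average_summable_on[OF G x] by (rule has_sum_infsum)
  then have "((\<lambda>l. u * (G k l * x l) + v * G k l) has_sum (u * (\<Sum>\<^sub>\<infinity>l. G k l * x l) + v * 1)) UNIV"
    by (intro has_sum_add has_sum_cmult_right row_stochasticD(2)[OF G])
  then show ?thesis
    by (intro infsumI) (simp add: algebra_simps)
qed

lemma weighted_average_mono:
  assumes G: "row_stochastic G" and x: "range x \<subseteq> {a..b}" and y: "range y \<subseteq> {c..d}"
    and "\<And>l. x l \<le> y l"
  shows "(\<Sum>\<^sub>\<infinity>l. G k l * x l) \<le> (\<Sum>\<^sub>\<infinity>l. G k l * y l)"
  using assms row_stochasticD(1)[OF G]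
  by (intro infsum_mono weighted_average_summable_on[OF G x] weighted_average_summable_on[OF G y]
        mult_left_mono) auto

lemma weighted_average_range:
  assumes G: "row_stochastic G" and x: "range x \<subseteq> {a..b}"
  shows "range (\<lambda>k. \<Sum>\<^sub>\<infinity>l. G k l * x l) \<subseteq> {a..b}"
proof -
  \<comment> \<open>The case \<open>u = 0\<close>: averaging fixes constants, so the interval ends
    can be compared with \<open>x\<close> by monotonicity.\<close>
  have const: "(\<Sum>\<^sub>\<infinity>l. G k l * v) = v" for k and v :: real
    using weighted_average_affine[OF G x, of k 0 v] by simp
  have "a \<le> (\<Sum>\<^sub>\<infinity>l. G k l * x l) \<and> (\<Sum>\<^sub>\<infinity>l. G k l * x l) \<le> b" for k
  proof
    show "a \<le> (\<Sum>\<^sub>\<infinity>l. G k l * x l)"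
      using weighted_average_mono[OF G _ x, of "\<lambda>_. a" a a k] x by (auto simp: const image_subset_iff)
    show "(\<Sum>\<^sub>\<infinity>l. G k l * x l) \<le> b"
      using weighted_average_mono[OF G x, of "\<lambda>_. b" b b k] x by (auto simp: const image_subset_iff)
  qed
  then show ?thesis by auto
qed

section \<open>Lower bounds propagated along the trees within one block\<close>

lemma sum_infsum_disjoint:
  fixes f :: "'a \<Rightarrow> real" and V :: "'m::finite \<Rightarrow> 'a set"
  assumes "\<And>S. f summable_on S" and "\<And>j j'. j \<noteq> j' \<Longrightarrow> V j \<inter> V j' = {}"
  shows "(\<Sum>j\<in>UNIV. infsum f (V j)) = infsum f (\<Union>j. V j)"
proof -
  have "(\<Sum>j\<in>J. infsum f (V j)) = infsum f (\<Union>j\<in>J. V j)" if "finite J" for J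
    using that
  proof induction
    case (insert j J)
    have "V j \<inter> (\<Union>j\<in>J. V j) = {}"
    proof -
      have "V j \<inter> V j' = {}" if "j' \<in> J" for j'
        using assms(2) insert.hyps(2) that by metis
      then show ?thesis by auto
    qed
    then have "infsum f (V j \<union> (\<Union>j\<in>J. V j)) = infsum f (V j) + infsum f (\<Union>j\<in>J. V j)"
      by (intro infsum_Un_disjoint assms(1))
    with insert show ?case by simp
  qed simp
  from this[of UNIV] show ?thesis by simp
qed

text \<open>Both claims go through one induction. Nonnegativity of the comparison vector does not
  follow from the first claim, which only bounds it from above, but the first claim needs it when
  entries of \<open>B\<close> are replaced by larger weights.\<close>

lemma block_lower_bound:
  fixes G :: "nat \<Rightarrow> 'n \<Rightarrow> 'n \<Rightarrow> real" and z :: "nat \<Rightarrow> 'n \<Rightarrow> real"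
    and B :: "nat \<Rightarrow> real ^ 'm ^ 'm::finite" and V :: "nat \<Rightarrow> 'n \<Rightarrow> 'm \<Rightarrow> 'n set"
  assumes G: "\<And>s. row_stochastic (G s)"
    and z: "\<And>s. range (z s) \<subseteq> {0..c}"
    and z_Suc: "\<And>s k. z (Suc s) k = (\<Sum>\<^sub>\<infinity>l. G s k l * z s l)"
    and W_0: "\<And>j. W j 0 = {r j}"
    and B_nonneg: "\<And>s i j. s < N \<Longrightarrow> 0 \<le> B (a + s) $ i $ j"
    and B_le: "\<And>s i j k. s < N \<Longrightarrow> k \<in> W i (Suc s) \<Longrightarrow> B (a + s) $ i $ j \<le> infsum (G s k) (V s k j)"
    and V_sub: "\<And>s k j. s < N \<Longrightarrow> V s k j \<subseteq> W j s"
    and V_disj: "\<And>s k j j'. s < N \<Longrightarrow> j \<noteq> j' \<Longrightarrow> V s k j \<inter> V s k j' = {}"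
  shows "s \<le> N \<Longrightarrow> k \<in> W i s \<Longrightarrow> (left_product B a s *v (\<chi> j. z 0 (r j))) $ i \<le> z s k"
    and "s \<le> N \<Longrightarrow> 0 \<le> (left_product B a s *v (\<chi> j. z 0 (r j))) $ i"
proof (induction s arbitrary: i k)
  case 0
  {
    case 1
    then show ?case using W_0 by simp
  next
    case 2
    then show ?case using z[of 0] by (auto simp: image_subset_iff)
  }
next
  case (Suc s)
  define y where "y = left_product B a s *v (\<chi> j. z 0 (r j))"
  have step: "left_product B a (Suc s) *v (\<chi> j. z 0 (r j)) = B (a + s) *v y"
    by (simp add: y_def matrix_vector_mul_assoc)
  {
    case 1
    then have s: "s < N" by simp
    have y_nonneg: "0 \<le> y $ j" for j
      using Suc(2) s by (simp add: y_def)
    have summable: "(\<lambda>l. G s k l * z s l) summable_on S" for S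
      by (rule weighted_average_summable_on[OF G z])
    have "(B (a + s) *v y) $ i = (\<Sum>j\<in>UNIV. B (a + s) $ i $ j * y $ j)"
      by (simp add: matrix_vector_mult_def)
    also have "\<dots> \<le> (\<Sum>j\<in>UNIV. infsum (G s k) (V s k j) * y $ j)"
      using B_le[OF s 1(2)] y_nonneg by (intro sum_mono mult_right_mono) auto
    also have "\<dots> = (\<Sum>j\<in>UNIV. \<Sum>\<^sub>\<infinity>l\<in>V s k j. G s k l * y $ j)"
      by (simp add: infsum_cmult_left')
    also have "\<dots> \<le> (\<Sum>j\<in>UNIV. \<Sum>\<^sub>\<infinity>l\<in>V s k j. G s k l * z s l)"
    proof (intro sum_mono infsum_mono mult_left_mono)
      \<comment> \<open>The induction hypothesis applies to \<open>l\<close> because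
        \<open>V s k j\<close> lies inside \<open>W j s\<close>.\<close>
      show "y $ j \<le> z s l" if "l \<in> V s k j" for j l
        using Suc(1)[of l j] V_sub[OF s] that s by (auto simp: y_def)
      show "0 \<le> G s k l" for l by (rule row_stochasticD(1)[OF G])
    qed (intro summable summable_on_cmult_left row_stochastic_summable_on G)+
    also have "\<dots> = (\<Sum>\<^sub>\<infinity>l\<in>(\<Union>j. V s k j). G s k l * z s l)"
      using V_disj[OF s] by (intro sum_infsum_disjoint summable) auto
    \<comment> \<open>The terms outside the union are nonnegative, as \<open>z s\<close> takes
      values in \<open>{0..c}\<close>.\<close>
    also have "\<dots> \<le> (\<Sum>\<^sub>\<infinity>l. G s k l * z s l)"
      using z[of s] row_stochasticD(1)[OF G]
      by (intro infsum_mono_neutral summable mult_nonneg_nonneg) (auto simp: image_subset_iff)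
    also have "\<dots> = z (Suc s) k" by (simp add: z_Suc)
    finally show ?case by (simp only: step)
  next
    case 2
    then show ?case
      using B_nonneg[of s] Suc(2) unfolding step matrix_vector_mult_def[of "B (a + s)"]
      by (auto simp: y_def intro!: sum_nonneg mult_nonneg_nonneg)
  }
qed

section \<open>Diameters and enclosing intervals\<close>

lemma diameter_le:
  assumes "range x \<subseteq> {a..b}"
  shows "diameter x \<le> ennreal (b - a)"
proof -
  have "(SUP k. ereal (x k)) - (INF k. ereal (x k)) \<le> ereal b - ereal a"
    using assms by (intro ereal_minus_mono SUP_least INF_greatest) (auto simp: image_subset_iff)
  then show ?thesis
    using e2ennreal_mono by (fastforce simp: diameter_def)
qed

text \<open>A finite difference of supremum and infimum forces both to be finite. Hence every
  initial state that enters the contraction rate is bounded, and the sums defining its trajectory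
  converge.\<close>

lemma diameter_attained:
  assumes "diameter x < \<infinity>"
  obtains a b where "range x \<subseteq> {a..b}" and "diameter x = ennreal (b - a)"
proof -
  define S where "S = (SUP k. ereal (x k))"
  define I where "I = (INF k. ereal (x k))"
  have S: "ereal (x k) \<le> S" and I: "I \<le> ereal (x k)" for k
    by (auto simp: S_def I_def intro: SUP_upper INF_lower)
  have fin: "S - I \<noteq> \<infinity>"
    using assms by (auto simp: diameter_def S_def I_def)
  \<comment> \<open>Any node, here \<open>undefined\<close>, excludes \<open>S\<close> being minus
    infinity and \<open>I\<close> being plus infinity; \<open>fin\<close> excludes the remaining
    infinite cases.\<close>
  obtain b where b: "S = ereal b"
    using fin S[of undefined] I[of undefined] by (cases S; cases I) auto
  obtain a where a: "I = ereal a"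
    using fin S[of undefined] I[of undefined] by (cases S; cases I) auto
  show ?thesis
  proof (rule that)
    show "range x \<subseteq> {a..b}" using S I by (auto simp: a b)
    show "diameter x = ennreal (b - a)"
      by (simp add: diameter_def S_def[symmetric] I_def[symmetric] a b)
  qed
qed

section \<open>Growth rates sampled at the block times\<close>

lemma strict_mono_block:
  fixes tp :: "nat \<Rightarrow> nat"
  assumes "strict_mono tp" and "tp p0 \<le> t"
  obtains p where "p0 \<le> p" and "tp p \<le> t" and "t < tp (Suc p)"
proof -
  \<comment> \<open>A strictly increasing sequence of naturals satisfies \<open>p <= tp p\<close>,
    so the candidates are bounded and the greatest one exists.\<close>
  have bound: "\<And>p. tp p \<le> t \<Longrightarrow> p \<le> t"
    using strict_mono_imp_increasing[OF assms(1)] by (meson le_trans)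
  define p where "p = (GREATEST p. tp p \<le> t)"
  have "tp p \<le> t"
    unfolding p_def by (rule GreatestI_nat[where b = t]) (use assms bound in auto)
  moreover have le: "q \<le> p" if "tp q \<le> t" for q
    unfolding p_def by (rule Greatest_le_nat[where b = t]) (use that bound in auto)
  moreover have "t < tp (Suc p)"
    using le[of "Suc p"] by (meson not_less Suc_n_not_le_n)
  ultimately show ?thesis using that assms(2) by blast
qed

text \<open>Gaps are eventually below \<open>T + 1\<close>, while the block times tend to
  infinity.\<close>

lemma strict_mono_ratio_tendsto_1:
  fixes tp :: "nat \<Rightarrow> nat"
  assumes mono: "strict_mono tp"
    and gap: "limsup (\<lambda>p. ereal (real (tp (Suc p)) - real (tp p))) \<le> ereal (real T)"
  shows "(\<lambda>p. real (tp p) / real (tp (Suc p))) \<longlonglongrightarrow> 1"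
proof -
  \<comment> \<open>Adding 1 makes the bound strict, so that it holds eventually for the gaps
    themselves.\<close>
  have "limsup (\<lambda>p. ereal (real (tp (Suc p)) - real (tp p))) < ereal (real T + 1)"
    using gap by (rule le_less_trans) simp
  then have ev: "\<forall>\<^sub>F p in sequentially. real (tp (Suc p)) - real (tp p) < real T + 1"
    by (auto dest!: Limsup_lessD)
  have "filterlim (\<lambda>p. tp (Suc p)) at_top sequentially"
    using filterlim_subseq[OF mono] by (rule filterlim_compose) (rule filterlim_Suc)
  then have "filterlim (\<lambda>p. real (tp (Suc p))) at_top sequentially"
    by (rule filterlim_compose[OF filterlim_real_sequentially])
  then have lim0: "(\<lambda>p. (real T + 1) / real (tp (Suc p))) \<longlonglongrightarrow> 0"
    by (rule real_tendsto_divide_at_top[OF tendsto_const])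
  have pos: "0 < tp (Suc p)" and less: "tp p < tp (Suc p)" for p
    using strict_monoD[OF mono, of p "Suc p"] by auto
  show ?thesis
  proof (rule tendsto_sandwich)
    show "(\<lambda>p. 1 - (real T + 1) / real (tp (Suc p))) \<longlonglongrightarrow> 1"
      using tendsto_diff[OF tendsto_const lim0, of 1] by simp
    show "\<forall>\<^sub>F p in sequentially. 1 - (real T + 1) / real (tp (Suc p)) \<le> real (tp p) / real (tp (Suc p))"
      using ev
    proof eventually_elim
      case (elim p)
      then have "1 - (real T + 1) / real (tp (Suc p)) = (real (tp (Suc p)) - (real T + 1)) / real (tp (Suc p))"
        using pos[of p] by (simp add: diff_divide_distrib)
      also have "\<dots> \<le> real (tp p) / real (tp (Suc p))"
        using elim by (intro divide_right_mono) auto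
      finally show ?case .
    qed
    show "\<forall>\<^sub>F p in sequentially. real (tp p) / real (tp (Suc p)) \<le> 1"
      using less by (intro always_eventually allI) (simp add: divide_le_eq less_imp_le)
  qed simp
qed

text \<open>
  For \<open>t\<close> between \<open>tp (p + 1)\<close> and \<open>tp (p + 2)\<close> the exponent is at least \<open>1 / tp (p + 2)\<close>, while
  the right-hand side has \<open>1 / tp (p + 1)\<close>. Their ratio tends to \<open>1\<close>, which costs nothing in
  the limit.
\<close>

lemma limsup_block_rate_le:
  fixes tp :: "nat \<Rightarrow> nat" and P :: "nat \<Rightarrow> real" and q :: "nat \<Rightarrow> ennreal"
  assumes mono: "strict_mono tp"
    and gap: "limsup (\<lambda>p. ereal (real (tp (Suc p)) - real (tp p))) \<le> ereal (real T)"
    and P: "\<And>p. P p \<in> {0..1}"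
    and q: "\<And>p t. tp (Suc p) \<le> t \<Longrightarrow> q t \<le> ennreal (P p)"
  shows "limsup (\<lambda>t. ennreal_powr (q t) (1 / real t))
    \<le> limsup (\<lambda>p. ennreal (P p powr (1 / real (tp (Suc p)))))"
proof (rule dense_ge)
  fix y assume "limsup (\<lambda>p. ennreal (P p powr (1 / real (tp (Suc p))))) < y"
  \<comment> \<open>The room between \<open>c'\<close> and \<open>y\<close> absorbs the exponent:
    \<open>c\<close> raised to the ratio of successive block times tends to \<open>c\<close>, hence
    is eventually below \<open>y\<close>.\<close>
  then obtain c' where c': "limsup (\<lambda>p. ennreal (P p powr (1 / real (tp (Suc p))))) < c'" "c' < y"
    using dense by blast
  then obtain c where c: "c' = ennreal c" "0 \<le> c" by (cases c') auto
  \<comment> \<open>A strict upper bound of a limit superior in \<open>ennreal\<close> is positive;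
    continuity of \<open>powr\<close> at base \<open>c\<close> relies on this.\<close>
  have "c > 0" using c' c by (auto simp: less_le)
  have pos: "0 < tp (Suc p)" for p
    using strict_monoD[OF mono, of p "Suc p"] by auto
  have "(\<lambda>p. real (tp (Suc p)) / real (tp (Suc (Suc p)))) \<longlonglongrightarrow> 1"
    by (rule LIMSEQ_Suc[OF strict_mono_ratio_tendsto_1[OF mono gap]])
  then have "(\<lambda>p. c powr (real (tp (Suc p)) / real (tp (Suc (Suc p))))) \<longlonglongrightarrow> c powr 1"
    using \<open>c > 0\<close> by (intro tendsto_powr tendsto_const) auto
  then have "(\<lambda>p. ennreal (c powr (real (tp (Suc p)) / real (tp (Suc (Suc p)))))) \<longlonglongrightarrow> ennreal c"
    using \<open>c > 0\<close> by (intro tendsto_ennrealI) simp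
  then have "\<forall>\<^sub>F p in sequentially. ennreal (c powr (real (tp (Suc p)) / real (tp (Suc (Suc p))))) < y"
    using c' c by (intro order_tendstoD) auto
  moreover have "\<forall>\<^sub>F p in sequentially. P p powr (1 / real (tp (Suc p))) < c"
    using Limsup_lessD[OF c'(1)] by eventually_elim (simp add: c ennreal_less_iff)
  ultimately have "\<forall>\<^sub>F p in sequentially. P p powr (1 / real (tp (Suc p))) < c \<and>
      ennreal (c powr (real (tp (Suc p)) / real (tp (Suc (Suc p))))) < y"
    by eventually_elim simp
  then obtain p0 where p0: "\<And>p. p \<ge> p0 \<Longrightarrow> P p powr (1 / real (tp (Suc p))) < c \<and>
      ennreal (c powr (real (tp (Suc p)) / real (tp (Suc (Suc p))))) < y"
    by (auto simp: eventually_sequentially)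
  have "ennreal_powr (q t) (1 / real t) \<le> y" if t: "t \<ge> tp (Suc p0)" for t
  proof -
    \<comment> \<open>The bound \<open>Suc p0 <= p'\<close> makes \<open>p'\<close> a successor
      \<open>Suc p\<close> with \<open>p0 <= p\<close>, which fits the shifted index in
      \<open>q\<close>.\<close>
    from strict_mono_block[OF mono t] obtain p' where
      "Suc p0 \<le> p'" "tp p' \<le> t" "t < tp (Suc p')" .
    then obtain p where p: "p0 \<le> p" "tp (Suc p) \<le> t" "t < tp (Suc (Suc p))"
      by (cases p') auto
    have t_pos: "0 < t" using pos[of p] p by simp
    have P01: "0 \<le> P p" "P p \<le> 1" using P[of p] by auto
    have q_le: "q t \<le> ennreal (P p)" by (rule q[OF p(2)])
    then have q_fin: "q t \<noteq> \<infinity>" by (auto simp: top_unique)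
    have "enn2real (q t) \<le> P p"
      using q_le P01 by (simp add: enn2real_leI)
    then have "enn2real (q t) powr (1 / real t) \<le> P p powr (1 / real t)"
      by (intro powr_mono2) auto
    \<comment> \<open>Since \<open>P p\<close> is at most 1, lowering the exponent raises the
      power.\<close>
    also have "\<dots> \<le> P p powr (1 / real (tp (Suc (Suc p))))"
      using P01 t_pos p by (intro powr_mono') (auto simp: frac_le)
    also have "\<dots> = (P p powr (1 / real (tp (Suc p)))) powr (real (tp (Suc p)) / real (tp (Suc (Suc p))))"
      using pos[of p] by (simp add: powr_powr)
    also have "\<dots> \<le> c powr (real (tp (Suc p)) / real (tp (Suc (Suc p))))"
      using p0[OF p(1)] by (intro powr_mono2) auto
    finally have "ennreal (enn2real (q t) powr (1 / real t))
        \<le> ennreal (c powr (real (tp (Suc p)) / real (tp (Suc (Suc p)))))"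
      by (rule ennreal_leI)
    also have "\<dots> \<le> y" using p0[OF p(1)] by auto
    finally show ?thesis using q_fin by (simp add: ennreal_powr_def)
  qed
  then show "limsup (\<lambda>t. ennreal_powr (q t) (1 / real t)) \<le> y"
    by (intro Limsup_bounded) (auto simp: eventually_sequentially)
qed

section \<open>Contraction of the state over one block\<close>

lemma state_range_mono:
  assumes G: "\<And>t. row_stochastic (\<Gamma> t)" and "range (state \<Gamma> x0 t) \<subseteq> {a..b}" and "t \<le> t'"
  shows "range (state \<Gamma> x0 t') \<subseteq> {a..b}"
  using assms(3)
proof (induction rule: dec_induct)
  case base
  show ?case by (rule assms(2))
next
  case (step t)
  then show ?case using weighted_average_range[OF G] by simp
qed

text \<open>Working with an enclosing interval instead of the diameter lets the estimate be iterated
  without its ends being the extremes of the state. The index \<open>i\<close> stays free, to be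
  chosen as a maximiser later.\<close>

lemma block_contraction:
  fixes \<Gamma> :: "nat \<Rightarrow> 'n \<Rightarrow> 'n \<Rightarrow> real" and B :: "nat \<Rightarrow> real ^ 'm ^ 'm::finite"
    and V :: "nat \<Rightarrow> 'n \<Rightarrow> 'm \<Rightarrow> 'n set"
  assumes G: "\<And>t. row_stochastic (\<Gamma> t)"
    and x: "range (state \<Gamma> x0 a) \<subseteq> {lo..hi}"
    and W_0: "\<And>j. \<exists>k. W j 0 = {k}"
    and W_N: "\<And>j. W j N = UNIV"
    and B_nonneg: "\<And>s i j. s < N \<Longrightarrow> 0 \<le> B (a + s) $ i $ j"
    and B_le: "\<And>s i j k. s < N \<Longrightarrow> k \<in> W i (Suc s) \<Longrightarrow>
      B (a + s) $ i $ j \<le> infsum (\<Gamma> (a + s) k) (V s k j)"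
    and V_sub: "\<And>s k j. s < N \<Longrightarrow> V s k j \<subseteq> W j s"
    and V_disj: "\<And>s k j j'. s < N \<Longrightarrow> j \<noteq> j' \<Longrightarrow> V s k j \<inter> V s k j' = {}"
  shows "\<exists>lo' hi'. range (state \<Gamma> x0 (a + N)) \<subseteq> {lo'..hi'} \<and>
    hi' - lo' = (1 - (left_product B a N *v vec 1) $ i) * (hi - lo)"
proof -
  obtain r where r: "\<And>j. W j 0 = {r j}" using W_0 by metis
  define x where "x s = state \<Gamma> x0 (a + s)" for s
  have x_range: "range (x s) \<subseteq> {lo..hi}" for s
    unfolding x_def using state_range_mono[OF G x] by simp
  have x_Suc: "x (Suc s) k = (\<Sum>\<^sub>\<infinity>l. \<Gamma> (a + s) k l * x s l)" for s k
    by (simp add: x_def)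
  define L where "L = left_product B a N"
  have lower: "(L *v (\<chi> j. u * x 0 (r j) + v)) $ i \<le> u * x N k + v"
    if uv: "(u, v) \<in> {(1, -lo), (-1, hi)}" for u v k
    unfolding L_def
  proof (rule block_lower_bound(1)[where z = "\<lambda>s k. u * x s k + v" and G = "\<lambda>s. \<Gamma> (a + s)"
        and c = "hi - lo" and N = N and V = V and W = W])
    show "range (\<lambda>k. u * x s k + v) \<subseteq> {0..hi - lo}" for s
      using x_range[of s] uv by (auto simp: image_subset_iff)
    show "u * x (Suc s) k + v = (\<Sum>\<^sub>\<infinity>l. \<Gamma> (a + s) k l * (u * x s l + v))" for s k
      by (simp add: x_Suc weighted_average_affine[OF G x_range])
  qed (use G r W_N B_nonneg B_le V_sub V_disj in auto)
  \<comment> \<open>Adding the bounds for \<open>x - lo\<close> and \<open>hi - x\<close> cancels the unknown root values \<open>x 0 (r j)\<close>.\<close>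
  have L_sum: "(L *v (\<chi> j. u * x 0 (r j) + v)) $ i
      = u * (L *v (\<chi> j. x 0 (r j))) $ i + v * (L *v vec 1) $ i" for u v
    by (simp add: matrix_vector_mult_def sum.distrib algebra_simps sum_distrib_left)
  define e where "e = (L *v vec 1) $ i"
  define w where "w = (L *v (\<chi> j. x 0 (r j))) $ i"
  show ?thesis
  proof (intro exI conjI)
    \<comment> \<open>The ends come from solving \<open>w - lo * e <= x N k - lo\<close> and
      \<open>hi * e - w <= hi - x N k\<close> for \<open>x N k\<close>.\<close>
    show "range (state \<Gamma> x0 (a + N)) \<subseteq> {w + (1 - e) * lo..w + (1 - e) * hi}"
      using lower[of 1 "-lo"] lower[of "-1" hi]
      unfolding L_sum e_def[symmetric] w_def[symmetric] x_def[symmetric]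
      by (auto simp: algebra_simps)
    show "w + (1 - e) * hi - (w + (1 - e) * lo) = (1 - (left_product B a N *v vec 1) $ i) * (hi - lo)"
      by (simp add: e_def L_def algebra_simps)
  qed
qed

text \<open>A sub-stochastic matrix maps vectors with entries in \<open>{0..1}\<close> to such
  vectors. This keeps the contraction factors in \<open>{0..1}\<close>.\<close>

lemma sub_stochastic_left_product:
  assumes "\<And>s. s < n \<Longrightarrow> sub_stochastic (B (a + s))"
  shows "0 \<le> (left_product B a n *v vec 1) $ i \<and> (left_product B a n *v vec 1) $ i \<le> 1"
  using assms
proof (induction n arbitrary: i)
  case (Suc n)
  define y where "y = left_product B a n *v vec 1"
  have y: "0 \<le> y $ j" "y $ j \<le> 1" for j
    using Suc by (auto simp: y_def)
  have B: "\<And>j. 0 \<le> B (a + n) $ i $ j" "(\<Sum>j\<in>UNIV. B (a + n) $ i $ j) \<le> 1"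
    using Suc.prems[of n] by (auto simp: sub_stochastic_def)
  have "left_product B a (Suc n) *v vec 1 = B (a + n) *v y"
    by (simp add: y_def matrix_vector_mul_assoc)
  then have eq: "(left_product B a (Suc n) *v vec 1) $ i = (\<Sum>j\<in>UNIV. B (a + n) $ i $ j * y $ j)"
    by (simp add: matrix_vector_mult_def)
  have "\<dots> \<le> (\<Sum>j\<in>UNIV. B (a + n) $ i $ j)"
    using y B by (intro sum_mono mult_left_le) auto
  with eq B y show ?case by (auto intro!: sum_nonneg)
qed simp

section \<open>Sub-stochasticity of the coefficients and the bound on the rate\<close>

theorem theorem7:
  fixes \<Gamma> :: "nat \<Rightarrow> 'n::countable \<Rightarrow> 'n \<Rightarrow> real"
    and T :: nat
    and tp :: "nat \<Rightarrow> nat"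
    and W :: "'m::finite \<Rightarrow> nat \<Rightarrow> nat \<Rightarrow> 'n set"
    and V :: "'n \<Rightarrow> 'm \<Rightarrow> nat \<Rightarrow> nat \<Rightarrow> 'n set"
    and \<alpha> :: "'m \<Rightarrow> 'm \<Rightarrow> nat \<times> nat \<Rightarrow> real"
  assumes stochastic: "\<And>t. row_stochastic (\<Gamma> t)"
    and T_pos: "0 < T"
    and connected: "T_sequentially_connected T CARD('m) (comm_graph \<Gamma>)"
    and times: "connecting_times T CARD('m) (comm_graph \<Gamma>) tp"
    and W_start: "\<And>p j. \<exists>k. W j p 0 = {k}"
    and W_step: "\<And>p j s. s < tp (Suc p) - tp p \<Longrightarrow>
          W j p (Suc s) \<subseteq> W j p s \<union> Neighbors (W j p s) (comm_graph \<Gamma> (tp p + s))"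
    and W_end: "\<And>p j. W j p (tp (Suc p) - tp p) = UNIV"
    and V_subset: "\<And>k j p t. (p, t) \<in> block_times tp \<Longrightarrow> V k j p (t - tp p) \<subseteq> W j p (t - tp p)"
    and V_disjoint: "\<And>k j j' p t. (p, t) \<in> block_times tp \<Longrightarrow> j \<noteq> j' \<Longrightarrow>
          V k j p (t - tp p) \<inter> V k j' p (t - tp p) = {}"
    and \<alpha>_range: "\<And>i j p t. (p, t) \<in> block_times tp \<Longrightarrow> \<alpha> i j (p, t) \<in> {0..1}"
    and \<alpha>_bound: "\<And>i j k p t. (p, t) \<in> block_times tp \<Longrightarrow> k \<in> W i p (t - tp p + 1) \<Longrightarrow>
          (\<Sum>\<^sub>\<infinity>l\<in>V k j p (t - tp p). \<Gamma> t k l) \<ge> \<alpha> i j (p, t)"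
  shows "(\<forall>(p, t)\<in>block_times tp. sub_stochastic (coeff_matrix \<alpha> p t)) \<and>
    contraction_rate \<Gamma> \<le>
      limsup (\<lambda>p. ennreal (\<Prod>p'\<in>{1..p}.
        (1 - (MAX j. axis j 1 \<bullet>
                (left_product (coeff_matrix \<alpha> p') (tp p') (tp (Suc p') - tp p') *v vec 1)))
          powr (1 / real (tp (Suc p)))))"
proof
  have mono: "strict_mono tp"
    and gap: "limsup (\<lambda>p. ereal (real (tp (Suc p)) - real (tp p))) \<le> ereal (real T)"
    using times by (auto simp: connecting_times_def)
  define N where "N p = tp (Suc p) - tp p" for p
  have N: "tp p + N p = tp (Suc p)" for p
    using strict_monoD[OF mono, of p "Suc p"] by (simp add: N_def)
  have block: "(p, tp p + s) \<in> block_times tp" if "s < N p" for p s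
    using that by (auto simp: block_times_def N_def)
  \<comment> \<open>Descending induction from the full set at the end of the block: the empty set
    has no neighbours, so an empty set could only be followed by an empty one.\<close>
  have W_nonempty: "W j p s \<noteq> {}" if "s \<le> N p" for j p s
    using that
  proof (induction rule: inc_induct)
    case base
    then show ?case using W_end[of j p] by (simp add: N_def)
  next
    case (step s)
    then show ?case using W_step[of s p j] by (auto simp: N_def Neighbors_def)
  qed
  have sub: "sub_stochastic (coeff_matrix \<alpha> p (tp p + s))" if s: "s < N p" for p s
    unfolding sub_stochastic_def
  proof (intro conjI allI)
    note b = block[OF s]
    show "0 \<le> coeff_matrix \<alpha> p (tp p + s) $ i $ j" for i j
      using \<alpha>_range[OF b] by (auto simp: coeff_matrix_def)
    fix i
    \<comment> \<open>\<open>\<alpha>_bound\<close> says something about row \<open>i\<close> only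
      through a node of the next set; one such node bounds the row sum by disjoint parts of its row
      of \<Gamma>.\<close>
    obtain k where k: "k \<in> W i p (Suc s)"
      using W_nonempty[of "Suc s" p i] s by auto
    have "(\<Sum>j\<in>UNIV. coeff_matrix \<alpha> p (tp p + s) $ i $ j)
        \<le> (\<Sum>j\<in>UNIV. infsum (\<Gamma> (tp p + s) k) (V k j p s))"
      using \<alpha>_bound[OF b, of k i] k by (intro sum_mono) (simp add: coeff_matrix_def)
    also have "\<dots> = infsum (\<Gamma> (tp p + s) k) (\<Union>j. V k j p s)"
      using V_disjoint[OF b, of _ _ k]
      by (intro sum_infsum_disjoint row_stochastic_summable_on stochastic) auto
    also have "\<dots> \<le> infsum (\<Gamma> (tp p + s) k) UNIV"
      using row_stochasticD(1)[OF stochastic]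
      by (intro infsum_mono_neutral row_stochastic_summable_on stochastic) auto
    also have "\<dots> = 1"
      using row_stochasticD(2)[OF stochastic] by (rule infsumI)
    finally show "(\<Sum>j\<in>UNIV. coeff_matrix \<alpha> p (tp p + s) $ i $ j) \<le> 1" .
  qed
  show "\<forall>(p, t)\<in>block_times tp. sub_stochastic (coeff_matrix \<alpha> p t)"
  proof clarify
    fix p t assume "(p, t) \<in> block_times tp"
    then show "sub_stochastic (coeff_matrix \<alpha> p t)"
      using sub[of "t - tp p" p] by (auto simp: block_times_def N_def)
  qed
  define h where "h p i = (left_product (coeff_matrix \<alpha> p) (tp p) (N p) *v vec 1) $ i" for p i
  define \<eta> where "\<eta> p = (MAX i. h p i)" for p
  have h01: "0 \<le> h p i" "h p i \<le> 1" for p i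
    using sub_stochastic_left_product[of "N p" "coeff_matrix \<alpha> p" "tp p" i] sub
    by (auto simp: h_def)
  have \<eta>_in: "\<exists>i. \<eta> p = h p i" for p
  proof -
    have "\<eta> p \<in> range (h p)" unfolding \<eta>_def by (rule Max_in) auto
    then show ?thesis by auto
  qed
  have \<eta>01: "1 - \<eta> p \<in> {0..1}" for p
    using \<eta>_in[of p] h01 by auto
  define P where "P p = (\<Prod>p'\<in>{1..p}. 1 - \<eta> p')" for p
  have P01: "P p \<in> {0..1}" for p
    using \<eta>01 unfolding P_def by (auto intro!: prod_nonneg prod_le_1)
  have rate: "limsup (\<lambda>t. ennreal_powr (diameter (state \<Gamma> x0 t) / diameter x0) (1 / real t))
      \<le> limsup (\<lambda>p. ennreal (P p powr (1 / real (tp (Suc p)))))"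
    if x0: "0 < diameter x0" "diameter x0 < \<infinity>" for x0
  proof (rule limsup_block_rate_le[OF mono gap P01])
    obtain a b where ab: "range x0 \<subseteq> {a..b}" "diameter x0 = ennreal (b - a)"
      using diameter_attained[OF x0(2)] .
    have pos: "0 < b - a" using x0(1) ab(2) by (simp add: ennreal_less_zero_iff)
    \<comment> \<open>The product starts with block 1. Block 0 is covered by the base case, where
      the initial interval persists up to \<open>tp 1\<close> and \<open>P 0 = 1\<close>.\<close>
    have range_tp: "\<exists>lo hi. range (state \<Gamma> x0 (tp (Suc p))) \<subseteq> {lo..hi} \<and> hi - lo = P p * (b - a)" for p
    proof (induction p)
      case 0
      have "range (state \<Gamma> x0 (tp (Suc 0))) \<subseteq> {a..b}"
        using state_range_mono[where t = 0 and ?x0.0 = x0, OF stochastic] ab(1) by simp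
      then show ?case by (intro exI[of _ a] exI[of _ b]) (simp add: P_def)
    next
      case (Suc p)
      then obtain lo hi where lh: "range (state \<Gamma> x0 (tp (Suc p))) \<subseteq> {lo..hi}" "hi - lo = P p * (b - a)"
        by blast
      obtain i where i: "\<eta> (Suc p) = h (Suc p) i" using \<eta>_in by blast
      have "\<exists>lo' hi'. range (state \<Gamma> x0 (tp (Suc p) + N (Suc p))) \<subseteq> {lo'..hi'} \<and>
          hi' - lo' = (1 - h (Suc p) i) * (hi - lo)"
        unfolding h_def
      proof (rule block_contraction[OF stochastic lh(1), where N = "N (Suc p)" and i = i
            and B = "coeff_matrix \<alpha> (Suc p)" and V = "\<lambda>s k j. V k j (Suc p) s"
            and W = "\<lambda>j s. W j (Suc p) s"])
        fix s assume s: "s < N (Suc p)"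
        note b = block[OF s]
        show "0 \<le> coeff_matrix \<alpha> (Suc p) (tp (Suc p) + s) $ i $ j" for i j
          using \<alpha>_range[OF b] by (auto simp: coeff_matrix_def)
        show "coeff_matrix \<alpha> (Suc p) (tp (Suc p) + s) $ i $ j
            \<le> infsum (\<Gamma> (tp (Suc p) + s) k) (V k j (Suc p) s)"
          if "k \<in> W i (Suc p) (Suc s)" for i j k
          using \<alpha>_bound[OF b, of k i j] that by (simp add: coeff_matrix_def)
        show "V k j (Suc p) s \<subseteq> W j (Suc p) s" for k j
          using V_subset[OF b] by simp
        show "V k j (Suc p) s \<inter> V k j' (Suc p) s = {}" if "j \<noteq> j'" for k j j'
          using V_disjoint[OF b that] by simp
      qed (use W_start W_end in \<open>auto simp: N_def\<close>)
      then show ?case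
        by (simp add: N i lh(2) P_def mult_ac)
    qed
    have bound: "diameter (state \<Gamma> x0 t) \<le> ennreal (P p * (b - a))"
      if t: "tp (Suc p) \<le> t" for p t
    proof -
      obtain lo hi where lh: "range (state \<Gamma> x0 (tp (Suc p))) \<subseteq> {lo..hi}" "hi - lo = P p * (b - a)"
        using range_tp[of p] by blast
      show ?thesis
        using diameter_le[OF state_range_mono[OF stochastic lh(1) t]] by (simp only: lh(2))
    qed
    show "diameter (state \<Gamma> x0 t) / diameter x0 \<le> ennreal (P p)" if "tp (Suc p) \<le> t" for p t
      using divide_right_mono_ennreal[OF bound[OF that], of "ennreal (b - a)"] pos P01[of p]
      by (simp add: ab(2) divide_ennreal)
  qed
  have "P p powr r = (\<Prod>p'\<in>{1..p}. (1 - (MAX j. axis j 1 \<bullet>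
      (left_product (coeff_matrix \<alpha> p') (tp p') (tp (Suc p') - tp p') *v vec 1))) powr r)" for p r
  proof -
    \<comment> \<open>Nonnegative factors allow the power to be distributed over the
      product.\<close>
    have "P p powr r = (\<Prod>p'\<in>{1..p}. (1 - \<eta> p') powr r)"
      using \<eta>01 unfolding P_def by (simp only: prod_powr_distrib)
    then show ?thesis
      by (simp only: \<eta>_def h_def N_def inner_axis' inner_real_def mult_1)
  qed
  with rate show "contraction_rate \<Gamma> \<le> limsup (\<lambda>p. ennreal (\<Prod>p'\<in>{1..p}.
        (1 - (MAX j. axis j 1 \<bullet>
                (left_product (coeff_matrix \<alpha> p') (tp p') (tp (Suc p') - tp p') *v vec 1)))
          powr (1 / real (tp (Suc p)))))"
    unfolding contraction_rate_def by (intro SUP_least) simp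
qed

end
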